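(* Let $p^*:\mathcal D\to\mathcal C$ be a functor having a right adjoint $p_*$, with unit $\eta:1_{\mathcal D}\Rightarrow p_*p^*$. An arrow $f:c\to p^*(d)$ in $\mathcal C$ admits a cartesian lifting if and only if the pullback $d'$ of $\eta_d:d\to p_*p^*(d)$ along $p_*(f):p_*(c)\to p_*p^*(d)$ exists in $\mathcal D$ and, writing $q:d'\to p_*(c)$ for its projection, the transpose $q^t:p^*(d')\to c$ is an isomorphism. In particular, $p^*$ is a fibration if and only if this is true for all arrows of the form $f:c\to p^*(d)$.
   Context: For a functor $p:\mathcal D\to\mathcal C$, an arrow $v:d'\to d$ of $\mathcal D$ is cartesian if for every $g:d''\to d$ in $\mathcal D$ and every $h:p(d'')\to p(d')$ in $\mathcal C$ with $p(v)h=p(g)$ there is a unique $h':d''\to d'$ with $p(h')=h$ and $vh'=g$. A cartesian lifting of $f:c\to p(d)$ is a cartesian arrow $\widehat f:d'\to d$ together with an isomorphism $\sigma:p(d')\simeq c$ with $p(\widehat f)=f\sigma$. $p$ is a (Street) fibration if every arrow $f:c\to p(d)$ has a cartesian lifting. *)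

theory Defs
  imports Main
begin

text \<open>
  Categories are given by explicit carriers of objects and arrows. Operations are unconstrained
  outside the carriers. Composition is in applicative order: \<open>g \<cdot> f\<close> is ``first \<open>f\<close>, then \<open>g\<close>''.
\<close>

record ('o, 'm) cat =
  Obj :: "'o set"
  Arr :: "'m set"
  Dom :: "'m \<Rightarrow> 'o"
  Cod :: "'m \<Rightarrow> 'o"
  Id :: "'o \<Rightarrow> 'm"
  Comp :: "'m \<Rightarrow> 'm \<Rightarrow> 'm" (infixr "\<cdot>\<index>" 70)

definition Hom :: "('o, 'm) cat \<Rightarrow> 'o \<Rightarrow> 'o \<Rightarrow> 'm set" where
  "Hom C a b = {f \<in> Arr C. Dom C f = a \<and> Cod C f = b}"

locale category =
  fixes C :: "('o, 'm) cat" (structure)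
  assumes Dom_in_Obj: "f \<in> Arr C \<Longrightarrow> Dom C f \<in> Obj C"
    and Cod_in_Obj: "f \<in> Arr C \<Longrightarrow> Cod C f \<in> Obj C"
    and Id_in_Hom: "a \<in> Obj C \<Longrightarrow> Id C a \<in> Hom C a a"
    and Comp_in_Hom: "\<lbrakk>f \<in> Hom C a b; g \<in> Hom C b c\<rbrakk> \<Longrightarrow> g \<cdot> f \<in> Hom C a c"
    and Id_right: "f \<in> Hom C a b \<Longrightarrow> f \<cdot> Id C a = f"
    and Id_left: "f \<in> Hom C a b \<Longrightarrow> Id C b \<cdot> f = f"
    and Comp_assoc: "\<lbrakk>f \<in> Hom C a b; g \<in> Hom C b c; h \<in> Hom C c d\<rbrakk>
      \<Longrightarrow> (h \<cdot> g) \<cdot> f = h \<cdot> (g \<cdot> f)"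

definition is_iso :: "('o, 'm) cat \<Rightarrow> 'm \<Rightarrow> bool" where
  "is_iso C f \<longleftrightarrow> f \<in> Arr C \<and>
     (\<exists>g \<in> Hom C (Cod C f) (Dom C f).
        g \<cdot>\<^bsub>C\<^esub> f = Id C (Dom C f) \<and> f \<cdot>\<^bsub>C\<^esub> g = Id C (Cod C f))"

text \<open>
  \<open>is_pullback C f g x u v\<close>: the object \<open>x\<close> with projections \<open>u : x \<rightarrow> Dom f\<close> and
  \<open>v : x \<rightarrow> Dom g\<close> is a pullback of the cospan \<open>f, g\<close>.
\<close>

definition is_pullback :: "('o, 'm) cat \<Rightarrow> 'm \<Rightarrow> 'm \<Rightarrow> 'o \<Rightarrow> 'm \<Rightarrow> 'm \<Rightarrow> bool" where
  "is_pullback C f g x u v \<longleftrightarrow>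
     f \<in> Arr C \<and> g \<in> Arr C \<and> Cod C f = Cod C g \<and>
     u \<in> Hom C x (Dom C f) \<and> v \<in> Hom C x (Dom C g) \<and> f \<cdot>\<^bsub>C\<^esub> u = g \<cdot>\<^bsub>C\<^esub> v \<and>
     (\<forall>y s t. s \<in> Hom C y (Dom C f) \<longrightarrow> t \<in> Hom C y (Dom C g) \<longrightarrow>
        f \<cdot>\<^bsub>C\<^esub> s = g \<cdot>\<^bsub>C\<^esub> t \<longrightarrow>
        (\<exists>!w. w \<in> Hom C y x \<and> u \<cdot>\<^bsub>C\<^esub> w = s \<and> v \<cdot>\<^bsub>C\<^esub> w = t))"

record ('o1, 'm1, 'o2, 'm2) ftor =
  omap :: "'o1 \<Rightarrow> 'o2"
  amap :: "'m1 \<Rightarrow> 'm2"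

definition id_ftor :: "('o, 'm, 'o, 'm) ftor" where
  "id_ftor = \<lparr>omap = (\<lambda>a. a), amap = (\<lambda>f. f)\<rparr>"

definition comp_ftor ::
  "('o2, 'm2, 'o3, 'm3) ftor \<Rightarrow> ('o1, 'm1, 'o2, 'm2) ftor \<Rightarrow> ('o1, 'm1, 'o3, 'm3) ftor" where
  "comp_ftor G F = \<lparr>omap = (\<lambda>a. omap G (omap F a)), amap = (\<lambda>f. amap G (amap F f))\<rparr>"

locale is_ftor = A: category A + B: category B
  for A :: "('o1, 'm1) cat" and B :: "('o2, 'm2) cat" +
  fixes F :: "('o1, 'm1, 'o2, 'm2) ftor"
  assumes omap_in_Obj: "a \<in> Obj A \<Longrightarrow> omap F a \<in> Obj B"
    and amap_in_Hom: "f \<in> Hom A a b \<Longrightarrow> amap F f \<in> Hom B (omap F a) (omap F b)"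
    and amap_Id: "a \<in> Obj A \<Longrightarrow> amap F (Id A a) = Id B (omap F a)"
    and amap_Comp: "\<lbrakk>f \<in> Hom A a b; g \<in> Hom A b c\<rbrakk>
      \<Longrightarrow> amap F (g \<cdot>\<^bsub>A\<^esub> f) = amap F g \<cdot>\<^bsub>B\<^esub> amap F f"

definition is_nat_trans :: "('o1, 'm1) cat \<Rightarrow> ('o2, 'm2) cat \<Rightarrow>
    ('o1, 'm1, 'o2, 'm2) ftor \<Rightarrow> ('o1, 'm1, 'o2, 'm2) ftor \<Rightarrow> ('o1 \<Rightarrow> 'm2) \<Rightarrow> bool" where
  "is_nat_trans A B F G \<tau> \<longleftrightarrow>
     (\<forall>a \<in> Obj A. \<tau> a \<in> Hom B (omap F a) (omap G a)) \<and>
     (\<forall>a b. \<forall>f \<in> Hom A a b. amap G f \<cdot>\<^bsub>B\<^esub> \<tau> a = \<tau> b \<cdot>\<^bsub>B\<^esub> amap F f)"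

locale adjunction = L: is_ftor D C L + R: is_ftor C D R
  for D :: "('o1, 'm1) cat" and C :: "('o2, 'm2) cat"
    and L :: "('o1, 'm1, 'o2, 'm2) ftor" and R :: "('o2, 'm2, 'o1, 'm1) ftor" +
  fixes \<eta> :: "'o1 \<Rightarrow> 'm1" and \<epsilon> :: "'o2 \<Rightarrow> 'm2"
  assumes unit_nat: "is_nat_trans D D id_ftor (comp_ftor R L) \<eta>"
    and counit_nat: "is_nat_trans C C (comp_ftor L R) id_ftor \<epsilon>"
    and triangle_L: "d \<in> Obj D \<Longrightarrow> \<epsilon> (omap L d) \<cdot>\<^bsub>C\<^esub> amap L (\<eta> d) = Id C (omap L d)"
    and triangle_R: "c \<in> Obj C \<Longrightarrow> amap R (\<epsilon> c) \<cdot>\<^bsub>D\<^esub> \<eta> (omap R c) = Id D (omap R c)"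

text \<open>
  \<open>adj_transpose C L \<epsilon> c q : L d \<rightarrow> c\<close> is the adjoint transpose of \<open>q : d \<rightarrow> R c\<close>. The object \<open>c\<close> is an
  argument because it is not determined by the arrow \<open>q\<close>.
\<close>

definition adj_transpose :: "('o2, 'm2) cat \<Rightarrow> ('o1, 'm1, 'o2, 'm2) ftor \<Rightarrow> ('o2 \<Rightarrow> 'm2) \<Rightarrow>
    'o2 \<Rightarrow> 'm1 \<Rightarrow> 'm2" where
  "adj_transpose C L \<epsilon> c q = \<epsilon> c \<cdot>\<^bsub>C\<^esub> amap L q"

definition cartesian :: "('o1, 'm1) cat \<Rightarrow> ('o2, 'm2) cat \<Rightarrow> ('o1, 'm1, 'o2, 'm2) ftor \<Rightarrow>
    'm1 \<Rightarrow> bool" where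
  "cartesian D C p v \<longleftrightarrow> v \<in> Arr D \<and>
     (\<forall>d''. \<forall>g \<in> Hom D d'' (Cod D v). \<forall>h \<in> Hom C (omap p d'') (omap p (Dom D v)).
        amap p v \<cdot>\<^bsub>C\<^esub> h = amap p g \<longrightarrow>
        (\<exists>!h'. h' \<in> Hom D d'' (Dom D v) \<and> amap p h' = h \<and> v \<cdot>\<^bsub>D\<^esub> h' = g))"

text \<open>
  Cartesian liftings in Street's sense: the domain of \<open>f : c \<rightarrow> p d\<close> need only be matched up to an
  isomorphism \<open>\<sigma>\<close>. The object \<open>d\<close> is an argument because \<open>f\<close> only determines \<open>p d\<close>.
\<close>

definition is_cartesian_lifting :: "('o1, 'm1) cat \<Rightarrow> ('o2, 'm2) cat \<Rightarrow>
    ('o1, 'm1, 'o2, 'm2) ftor \<Rightarrow> 'o1 \<Rightarrow> 'm2 \<Rightarrow> 'm1 \<Rightarrow> 'm2 \<Rightarrow> bool" where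
  "is_cartesian_lifting D C p d f fh \<sigma> \<longleftrightarrow>
     cartesian D C p fh \<and> Cod D fh = d \<and>
     is_iso C \<sigma> \<and> \<sigma> \<in> Hom C (omap p (Dom D fh)) (Dom C f) \<and>
     amap p fh = f \<cdot>\<^bsub>C\<^esub> \<sigma>"

definition has_cartesian_lifting :: "('o1, 'm1) cat \<Rightarrow> ('o2, 'm2) cat \<Rightarrow>
    ('o1, 'm1, 'o2, 'm2) ftor \<Rightarrow> 'o1 \<Rightarrow> 'm2 \<Rightarrow> bool" where
  "has_cartesian_lifting D C p d f \<longleftrightarrow> (\<exists>fh \<sigma>. is_cartesian_lifting D C p d f fh \<sigma>)"

definition fibration :: "('o1, 'm1) cat \<Rightarrow> ('o2, 'm2) cat \<Rightarrow>
    ('o1, 'm1, 'o2, 'm2) ftor \<Rightarrow> bool" where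
  "fibration D C p \<longleftrightarrow> is_ftor D C p \<and>
     (\<forall>d \<in> Obj D. \<forall>c. \<forall>f \<in> Hom C c (omap p d). has_cartesian_lifting D C p d f)"

end

theory Submission
  imports Defs
begin

text \<open>
  Write \<open>L\<close> for the left adjoint, \<open>R\<close> for its right adjoint and \<open>q\<^sup>t\<close> for the transpose of
  \<open>q : y \<rightarrow> R c\<close>. Transposing the equation \<open>\<eta> d \<cdot> g = R f \<cdot> t\<close> of arrows \<open>y \<rightarrow> R (L d)\<close> turns it
  into the equation \<open>L g = f \<cdot> t\<^sup>t\<close> of arrows \<open>L y \<rightarrow> L d\<close>. Hence cones in \<open>D\<close> over the cospan
  \<open>\<eta> d, R f\<close> with vertex \<open>y\<close> correspond to pairs of \<open>g : y \<rightarrow> d\<close> and \<open>k : L y \<rightarrow> c\<close> with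
  \<open>L g = f \<cdot> k\<close>, and a cone \<open>(v, q)\<close> is a pullback exactly when the pair \<open>(v, q\<^sup>t)\<close> is universal
  among such pairs (lemma \<open>is_pullback_iff_universal_factorization\<close>).

  When \<open>s : L d' \<rightarrow> c\<close> is an isomorphism with \<open>L v = f \<cdot> s\<close>, every \<open>k : L y \<rightarrow> c\<close> is \<open>s \<cdot> h\<close> for
  exactly one \<open>h : L y \<rightarrow> L d'\<close>. Under this substitution universality of \<open>(v, s)\<close> becomes
  cartesianness of \<open>v\<close> (lemma \<open>universal_factorization_iff_cartesian\<close>). So a cartesian
  lifting of \<open>f\<close> is a universal pair whose second component is invertible, and since every \<open>s\<close> is
  the transpose of some \<open>q\<close>, it is a pullback whose projection \<open>q\<close> has an invertible transpose.
\<close>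

lemma HomD:
  assumes "f \<in> Hom C a b"
  shows "f \<in> Arr C" and "Dom C f = a" and "Cod C f = b"
  using assms by (simp_all add: Hom_def)

lemma (in category) Hom_in_Obj:
  assumes "f \<in> Hom C a b"
  shows "a \<in> Obj C" and "b \<in> Obj C"
  using assms Dom_in_Obj Cod_in_Obj by (auto simp: Hom_def)

lemma (in category) Ex1_Comp_iso:
  assumes iso: "is_iso C s" and s: "s \<in> Hom C a b" and k: "k \<in> Hom C x b"
  shows "\<exists>!h. h \<in> Hom C x a \<and> s \<cdot> h = k"
proof -
  obtain i where i: "i \<in> Hom C b a" and inv: "i \<cdot> s = Id C a" and si: "s \<cdot> i = Id C b"
    using iso s by (auto simp: is_iso_def Hom_def)
  show ?thesis
  proof (intro ex1I conjI)
    show "i \<cdot> k \<in> Hom C x a" by (rule Comp_in_Hom[OF k i])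
    show "s \<cdot> (i \<cdot> k) = k"
      using Comp_assoc[OF k i s] Id_left[OF k] by (simp add: si)
  next
    fix h assume h: "h \<in> Hom C x a \<and> s \<cdot> h = k"
    then show "h = i \<cdot> k"
      using Comp_assoc[of h x a s b i a] s i Id_left[of h x a] by (simp add: inv)
  qed
qed

section \<open>Transposition across an adjunction\<close>

context adjunction
begin

abbreviation transpose :: "'o2 \<Rightarrow> 'm1 \<Rightarrow> 'm2" where
  "transpose \<equiv> adj_transpose C L \<epsilon>"

definition cotranspose :: "'o1 \<Rightarrow> 'm2 \<Rightarrow> 'm1" where
  "cotranspose d k = amap R k \<cdot>\<^bsub>D\<^esub> \<eta> d"

lemma unit_in_Hom: "d \<in> Obj D \<Longrightarrow> \<eta> d \<in> Hom D d (omap R (omap L d))"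
  using unit_nat by (simp add: is_nat_trans_def id_ftor_def comp_ftor_def)

lemma unit_naturality:
  "h \<in> Hom D a b \<Longrightarrow> amap R (amap L h) \<cdot>\<^bsub>D\<^esub> \<eta> a = \<eta> b \<cdot>\<^bsub>D\<^esub> h"
  using unit_nat by (simp add: is_nat_trans_def id_ftor_def comp_ftor_def)

lemma counit_in_Hom: "c \<in> Obj C \<Longrightarrow> \<epsilon> c \<in> Hom C (omap L (omap R c)) c"
  using counit_nat by (simp add: is_nat_trans_def id_ftor_def comp_ftor_def)

lemma counit_naturality:
  "k \<in> Hom C a b \<Longrightarrow> k \<cdot>\<^bsub>C\<^esub> \<epsilon> a = \<epsilon> b \<cdot>\<^bsub>C\<^esub> amap L (amap R k)"
  using counit_nat by (simp add: is_nat_trans_def id_ftor_def comp_ftor_def)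

lemma transpose_in_Hom:
  assumes "c \<in> Obj C" and "q \<in> Hom D y (omap R c)"
  shows "transpose c q \<in> Hom C (omap L y) c"
  unfolding adj_transpose_def
  by (rule L.B.Comp_in_Hom[OF L.amap_in_Hom[OF assms(2)] counit_in_Hom[OF assms(1)]])

lemma cotranspose_in_Hom:
  assumes "y \<in> Obj D" and "k \<in> Hom C (omap L y) c"
  shows "cotranspose y k \<in> Hom D y (omap R c)"
  unfolding cotranspose_def
  by (rule L.A.Comp_in_Hom[OF unit_in_Hom[OF assms(1)] R.amap_in_Hom[OF assms(2)]])

lemma transpose_Comp:
  assumes "c \<in> Obj C" and "q \<in> Hom D x (omap R c)" and "h \<in> Hom D y x"
  shows "transpose c (q \<cdot>\<^bsub>D\<^esub> h) = transpose c q \<cdot>\<^bsub>C\<^esub> amap L h"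
  unfolding adj_transpose_def L.amap_Comp[OF assms(3,2)]
  by (rule L.B.Comp_assoc[OF L.amap_in_Hom[OF assms(3)] L.amap_in_Hom[OF assms(2)]
        counit_in_Hom[OF assms(1)], symmetric])

lemma transpose_amap_Comp:
  assumes f: "f \<in> Hom C c c'" and q: "q \<in> Hom D y (omap R c)"
  shows "transpose c' (amap R f \<cdot>\<^bsub>D\<^esub> q) = f \<cdot>\<^bsub>C\<^esub> transpose c q"
proof -
  note objs = L.B.Hom_in_Obj[OF f]
  have "transpose c' (amap R f \<cdot>\<^bsub>D\<^esub> q) = transpose c' (amap R f) \<cdot>\<^bsub>C\<^esub> amap L q"
    by (rule transpose_Comp[OF objs(2) R.amap_in_Hom[OF f] q])
  also have "\<dots> = (f \<cdot>\<^bsub>C\<^esub> \<epsilon> c) \<cdot>\<^bsub>C\<^esub> amap L q"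
    by (simp add: adj_transpose_def counit_naturality[OF f])
  also have "\<dots> = f \<cdot>\<^bsub>C\<^esub> transpose c q"
    unfolding adj_transpose_def
    by (rule L.B.Comp_assoc[OF L.amap_in_Hom[OF q] counit_in_Hom[OF objs(1)] f])
  finally show ?thesis .
qed

lemma transpose_unit_Comp:
  assumes g: "g \<in> Hom D y d"
  shows "transpose (omap L d) (\<eta> d \<cdot>\<^bsub>D\<^esub> g) = amap L g"
proof -
  have d: "d \<in> Obj D" by (rule L.A.Hom_in_Obj[OF g])
  have "transpose (omap L d) (\<eta> d \<cdot>\<^bsub>D\<^esub> g) = transpose (omap L d) (\<eta> d) \<cdot>\<^bsub>C\<^esub> amap L g"
    by (rule transpose_Comp[OF L.omap_in_Obj[OF d] unit_in_Hom[OF d] g])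
  also have "\<dots> = amap L g"
    using triangle_L[OF d] L.B.Id_left[OF L.amap_in_Hom[OF g]] by (simp add: adj_transpose_def)
  finally show ?thesis .
qed

lemma transpose_cotranspose:
  assumes y: "y \<in> Obj D" and k: "k \<in> Hom C (omap L y) c"
  shows "transpose c (cotranspose y k) = k"
  using transpose_amap_Comp[OF k unit_in_Hom[OF y]] triangle_L[OF y] L.B.Id_right[OF k]
  by (simp add: cotranspose_def adj_transpose_def)

lemma cotranspose_transpose:
  assumes c: "c \<in> Obj C" and q: "q \<in> Hom D y (omap R c)"
  shows "cotranspose y (transpose c q) = q"
proof -
  have y: "y \<in> Obj D" by (rule L.A.Hom_in_Obj[OF q])
  note Rc = R.omap_in_Obj[OF c]
  note R\<epsilon> = R.amap_in_Hom[OF counit_in_Hom[OF c]]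
  have "cotranspose y (transpose c q) = (amap R (\<epsilon> c) \<cdot>\<^bsub>D\<^esub> amap R (amap L q)) \<cdot>\<^bsub>D\<^esub> \<eta> y"
    by (simp add: cotranspose_def adj_transpose_def
        R.amap_Comp[OF L.amap_in_Hom[OF q] counit_in_Hom[OF c]])
  also have "\<dots> = amap R (\<epsilon> c) \<cdot>\<^bsub>D\<^esub> (\<eta> (omap R c) \<cdot>\<^bsub>D\<^esub> q)"
    unfolding unit_naturality[OF q, symmetric]
    by (rule L.A.Comp_assoc[OF unit_in_Hom[OF y] R.amap_in_Hom[OF L.amap_in_Hom[OF q]] R\<epsilon>])
  also have "\<dots> = q"
    using L.A.Comp_assoc[OF q unit_in_Hom[OF Rc] R\<epsilon>] triangle_R[OF c] L.A.Id_left[OF q] by simp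
  finally show ?thesis .
qed

lemma transpose_eq_iff:
  assumes "c \<in> Obj C" and "q \<in> Hom D y (omap R c)" and "t \<in> Hom D y (omap R c)"
  shows "transpose c q = transpose c t \<longleftrightarrow> q = t"
  using cotranspose_transpose[OF assms(1,2)] cotranspose_transpose[OF assms(1,3)] by metis

text \<open>
  Both sides of the left equation are arrows \<open>y \<rightarrow> R (L d)\<close>, so it may be tested after
  transposition; naturality of \<open>\<epsilon>\<close> and a triangle identity compute the two transposes.
\<close>

lemma unit_square_commutes_iff:
  assumes f: "f \<in> Hom C c (omap L d)" and g: "g \<in> Hom D y d" and t: "t \<in> Hom D y (omap R c)"
  shows "\<eta> d \<cdot>\<^bsub>D\<^esub> g = amap R f \<cdot>\<^bsub>D\<^esub> t \<longleftrightarrow> amap L g = f \<cdot>\<^bsub>C\<^esub> transpose c t"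
proof -
  have d: "d \<in> Obj D" by (rule L.A.Hom_in_Obj[OF g])
  show ?thesis
    using transpose_eq_iff[OF L.omap_in_Obj[OF d] L.A.Comp_in_Hom[OF g unit_in_Hom[OF d]]
        L.A.Comp_in_Hom[OF t R.amap_in_Hom[OF f]]]
    by (simp add: transpose_unit_Comp[OF g] transpose_amap_Comp[OF f t])
qed

section \<open>Universal factorizations through an arrow into the image of the left adjoint\<close>

text \<open>
  The pair \<open>(v, s)\<close> is a terminal object of the category whose objects are arrows \<open>g : y \<rightarrow> d\<close> with
  a factorization \<open>L g = f \<cdot> k\<close>. This is the common ground between pullbacks,
  which live in \<open>D\<close>, and cartesian liftings, which refer to the projection to \<open>C\<close>.
\<close>

definition universal_factorization ::
  "'o1 \<Rightarrow> 'o2 \<Rightarrow> 'm2 \<Rightarrow> 'o1 \<Rightarrow> 'm1 \<Rightarrow> 'm2 \<Rightarrow> bool" where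
  "universal_factorization d c f d' v s \<longleftrightarrow>
     v \<in> Hom D d' d \<and> s \<in> Hom C (omap L d') c \<and> amap L v = f \<cdot>\<^bsub>C\<^esub> s \<and>
     (\<forall>y. \<forall>g \<in> Hom D y d. \<forall>k \<in> Hom C (omap L y) c. amap L g = f \<cdot>\<^bsub>C\<^esub> k \<longrightarrow>
        (\<exists>!w. w \<in> Hom D y d' \<and> v \<cdot>\<^bsub>D\<^esub> w = g \<and> s \<cdot>\<^bsub>C\<^esub> amap L w = k))"

text \<open>
  Transposition is a bijection from cones \<open>(g, t)\<close> over \<open>\<eta> d, R f\<close> to factorizations
  \<open>(g, t\<^sup>t)\<close>, and it is natural in the vertex, so it preserves and reflects mediating arrows.
\<close>

lemma is_pullback_iff_universal_factorization:
  assumes d: "d \<in> Obj D" and f: "f \<in> Hom C c (omap L d)" and q: "q \<in> Hom D d' (omap R c)"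
  shows "is_pullback D (\<eta> d) (amap R f) d' v q \<longleftrightarrow>
         universal_factorization d c f d' v (transpose c q)"
proof -
  have c: "c \<in> Obj C" by (rule L.B.Hom_in_Obj[OF f])
  note \<eta> = HomD[OF unit_in_Hom[OF d]] and Rf = HomD[OF R.amap_in_Hom[OF f]]
  have mediates: "q \<cdot>\<^bsub>D\<^esub> w = t \<longleftrightarrow> transpose c q \<cdot>\<^bsub>C\<^esub> amap L w = transpose c t"
    if "w \<in> Hom D y d'" and "t \<in> Hom D y (omap R c)" for w y t
    using transpose_eq_iff[OF c L.A.Comp_in_Hom[OF that(1) q] that(2)]
    by (simp add: transpose_Comp[OF c q that(1)])
  have universal: "(\<forall>t \<in> Hom D y (omap R c). \<eta> d \<cdot>\<^bsub>D\<^esub> g = amap R f \<cdot>\<^bsub>D\<^esub> t \<longrightarrow>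
           (\<exists>!w. w \<in> Hom D y d' \<and> v \<cdot>\<^bsub>D\<^esub> w = g \<and> q \<cdot>\<^bsub>D\<^esub> w = t)) \<longleftrightarrow>
      (\<forall>k \<in> Hom C (omap L y) c. amap L g = f \<cdot>\<^bsub>C\<^esub> k \<longrightarrow>
           (\<exists>!w. w \<in> Hom D y d' \<and> v \<cdot>\<^bsub>D\<^esub> w = g \<and> transpose c q \<cdot>\<^bsub>C\<^esub> amap L w = k))"
    (is "(\<forall>t \<in> ?T. ?E t \<longrightarrow> ?P t) \<longleftrightarrow> (\<forall>k \<in> ?K. ?F k \<longrightarrow> ?Q k)")
    if g: "g \<in> Hom D y d" for y g
  proof -
    have y: "y \<in> Obj D" by (rule L.A.Hom_in_Obj[OF g])
    have E: "?E t \<longleftrightarrow> ?F (transpose c t)" if "t \<in> ?T" for t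
      by (rule unit_square_commutes_iff[OF f g that])
    have P: "?P t \<longleftrightarrow> ?Q (transpose c t)" if "t \<in> ?T" for t
      using mediates[OF _ that] by (metis (no_types, lifting))
    show ?thesis
    proof (intro iffI ballI impI)
      fix k assume *: "\<forall>t \<in> ?T. ?E t \<longrightarrow> ?P t" and k: "k \<in> ?K" and F: "?F k"
      have t: "cotranspose y k \<in> ?T" by (rule cotranspose_in_Hom[OF y k])
      have "?E (cotranspose y k)"
        using F by (simp only: E[OF t] transpose_cotranspose[OF y k])
      then have "?P (cotranspose y k)" by (rule bspec[OF * t, THEN mp])
      then show "?Q k" by (simp only: P[OF t] transpose_cotranspose[OF y k])
    next
      fix t assume *: "\<forall>k \<in> ?K. ?F k \<longrightarrow> ?Q k" and t: "t \<in> ?T" and "?E t"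
      then have "?F (transpose c t)" by (simp only: E[OF t])
      then have "?Q (transpose c t)"
        by (rule bspec[OF * transpose_in_Hom[OF c t], THEN mp])
      then show "?P t" by (simp only: P[OF t])
    qed
  qed
  have square: "\<eta> d \<cdot>\<^bsub>D\<^esub> v = amap R f \<cdot>\<^bsub>D\<^esub> q \<longleftrightarrow> amap L v = f \<cdot>\<^bsub>C\<^esub> transpose c q"
    if "v \<in> Hom D d' d"
    by (rule unit_square_commutes_iff[OF f that q])
  show ?thesis
    unfolding is_pullback_def universal_factorization_def \<eta> Rf
    using \<eta>(1) Rf(1) q transpose_in_Hom[OF c q]
    by (simp add: universal[unfolded Ball_def] square Ball_def cong: conj_cong)
qed

text \<open>
  Substituting \<open>k = s \<cdot> h\<close> turns the condition \<open>L g = f \<cdot> k\<close> into \<open>L g = L v \<cdot> h\<close> and the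
  condition \<open>s \<cdot> L w = k\<close> into \<open>L w = h\<close>, the latter because \<open>s\<close> is monic.
\<close>

lemma universal_factorization_iff_cartesian:
  assumes f: "f \<in> Hom C c (omap L d)" and v: "v \<in> Hom D d' d"
    and s: "s \<in> Hom C (omap L d') c" and iso: "is_iso C s" and Lv: "amap L v = f \<cdot>\<^bsub>C\<^esub> s"
  shows "universal_factorization d c f d' v s \<longleftrightarrow> cartesian D C L v"
proof -
  have E: "f \<cdot>\<^bsub>C\<^esub> (s \<cdot>\<^bsub>C\<^esub> h) = amap L v \<cdot>\<^bsub>C\<^esub> h" if "h \<in> Hom C x (omap L d')" for h x
    by (simp add: Lv L.B.Comp_assoc[OF that s f])
  have mediates: "s \<cdot>\<^bsub>C\<^esub> amap L w = s \<cdot>\<^bsub>C\<^esub> h \<longleftrightarrow> amap L w = h"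
    if "w \<in> Hom D y d'" and h: "h \<in> Hom C (omap L y) (omap L d')" for w y h
    using L.B.Ex1_Comp_iso[OF iso s L.B.Comp_in_Hom[OF h s]] L.amap_in_Hom[OF that(1)] h by blast
  have universal: "(\<forall>k \<in> Hom C (omap L y) c. amap L g = f \<cdot>\<^bsub>C\<^esub> k \<longrightarrow>
           (\<exists>!w. w \<in> Hom D y d' \<and> v \<cdot>\<^bsub>D\<^esub> w = g \<and> s \<cdot>\<^bsub>C\<^esub> amap L w = k)) \<longleftrightarrow>
      (\<forall>h \<in> Hom C (omap L y) (omap L d'). amap L v \<cdot>\<^bsub>C\<^esub> h = amap L g \<longrightarrow>
           (\<exists>!w. w \<in> Hom D y d' \<and> amap L w = h \<and> v \<cdot>\<^bsub>D\<^esub> w = g))"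
    (is "(\<forall>k \<in> ?K. ?F k \<longrightarrow> ?Q k) \<longleftrightarrow> (\<forall>h \<in> ?H. ?G h \<longrightarrow> ?P h)") for y g
  proof -
    have P: "?P h \<longleftrightarrow> ?Q (s \<cdot>\<^bsub>C\<^esub> h)" if "h \<in> ?H" for h
      using mediates[OF _ that] by (metis (no_types, lifting))
    have G: "?G h \<longleftrightarrow> ?F (s \<cdot>\<^bsub>C\<^esub> h)" if "h \<in> ?H" for h
      using E[OF that] by auto
    show ?thesis
    proof (intro iffI ballI impI)
      fix h assume *: "\<forall>k \<in> ?K. ?F k \<longrightarrow> ?Q k" and h: "h \<in> ?H" and "?G h"
      then have "?F (s \<cdot>\<^bsub>C\<^esub> h)" by (simp only: G[OF h])
      then have "?Q (s \<cdot>\<^bsub>C\<^esub> h)" by (rule bspec[OF * L.B.Comp_in_Hom[OF h s], THEN mp])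
      then show "?P h" by (simp only: P[OF h])
    next
      fix k assume *: "\<forall>h \<in> ?H. ?G h \<longrightarrow> ?P h" and k: "k \<in> ?K" and F: "?F k"
      obtain h where h: "h \<in> ?H" and k_eq: "s \<cdot>\<^bsub>C\<^esub> h = k"
        using ex1_implies_ex[OF L.B.Ex1_Comp_iso[OF iso s k]] by blast
      have "?G h" using F unfolding G[OF h] k_eq .
      then have "?P h" by (rule bspec[OF * h, THEN mp])
      then show "?Q k" by (simp only: P[OF h] k_eq)
    qed
  qed
  show ?thesis
    unfolding universal_factorization_def cartesian_def HomD[OF v]
    by (simp only: universal v s Lv[symmetric] HomD(1)[OF v] simp_thms)
qed

lemma has_cartesian_lifting_iff_universal_factorization:
  assumes f: "f \<in> Hom C c (omap L d)"
  shows "has_cartesian_lifting D C L d f \<longleftrightarrow>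
         (\<exists>d' v s. universal_factorization d c f d' v s \<and> is_iso C s)"
proof
  assume "has_cartesian_lifting D C L d f"
  then obtain v s where cart: "cartesian D C L v" and "Cod D v = d" and iso: "is_iso C s"
    and s: "s \<in> Hom C (omap L (Dom D v)) c" and Lv: "amap L v = f \<cdot>\<^bsub>C\<^esub> s"
    unfolding has_cartesian_lifting_def is_cartesian_lifting_def HomD[OF f] by blast
  then have v: "v \<in> Hom D (Dom D v) d" by (simp add: cartesian_def Hom_def)
  show "\<exists>d' v s. universal_factorization d c f d' v s \<and> is_iso C s"
    using universal_factorization_iff_cartesian[OF f v s iso Lv] cart iso by blast
next
  assume "\<exists>d' v s. universal_factorization d c f d' v s \<and> is_iso C s"
  then obtain d' v s where uni: "universal_factorization d c f d' v s" and iso: "is_iso C s"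
    by blast
  then have v: "v \<in> Hom D d' d" and s: "s \<in> Hom C (omap L d') c" and Lv: "amap L v = f \<cdot>\<^bsub>C\<^esub> s"
    by (simp_all add: universal_factorization_def)
  have "is_cartesian_lifting D C L d f v s"
    using universal_factorization_iff_cartesian[OF f v s iso Lv] uni iso s Lv
    by (simp add: is_cartesian_lifting_def HomD[OF v] HomD[OF f])
  then show "has_cartesian_lifting D C L d f"
    unfolding has_cartesian_lifting_def by blast
qed

theorem has_cartesian_lifting_iff_pullback:
  assumes d: "d \<in> Obj D" and f: "f \<in> Hom C c (omap L d)"
  shows "has_cartesian_lifting D C L d f \<longleftrightarrow>
         (\<exists>d' r q. is_pullback D (\<eta> d) (amap R f) d' r q \<and> is_iso C (transpose c q))"
proof -
  note pullback_iff = is_pullback_iff_universal_factorization[OF d f]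
  show ?thesis
    unfolding has_cartesian_lifting_iff_universal_factorization[OF f]
  proof
    assume "\<exists>d' v s. universal_factorization d c f d' v s \<and> is_iso C s"
    then obtain d' v s where uni: "universal_factorization d c f d' v s" and iso: "is_iso C s"
      by blast
    then have v: "v \<in> Hom D d' d" and s: "s \<in> Hom C (omap L d') c"
      by (simp_all add: universal_factorization_def)
    have d': "d' \<in> Obj D" by (rule L.A.Hom_in_Obj[OF v])
    show "\<exists>d' r q. is_pullback D (\<eta> d) (amap R f) d' r q \<and> is_iso C (transpose c q)"
      using pullback_iff[OF cotranspose_in_Hom[OF d' s]] transpose_cotranspose[OF d' s] uni iso
      by metis
  next
    assume "\<exists>d' r q. is_pullback D (\<eta> d) (amap R f) d' r q \<and> is_iso C (transpose c q)"
    then obtain d' r q where pb: "is_pullback D (\<eta> d) (amap R f) d' r q"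
      and iso: "is_iso C (transpose c q)"
      by blast
    have q: "q \<in> Hom D d' (omap R c)"
      using pb by (simp add: is_pullback_def HomD[OF R.amap_in_Hom[OF f]])
    show "\<exists>d' v s. universal_factorization d c f d' v s \<and> is_iso C s"
      using pullback_iff[OF q] pb iso by blast
  qed
qed

end

section \<open>Cartesian liftings along a left adjoint\<close>

theorem proposition5p1p3:
  fixes D :: "('o1, 'm1) cat" and C :: "('o2, 'm2) cat"
    and p_up :: "('o1, 'm1, 'o2, 'm2) ftor" and p_low :: "('o2, 'm2, 'o1, 'm1) ftor"
    and \<eta> :: "'o1 \<Rightarrow> 'm1" and \<epsilon> :: "'o2 \<Rightarrow> 'm2"
  assumes "adjunction D C p_up p_low \<eta> \<epsilon>"
  shows "(\<forall>d \<in> Obj D. \<forall>c. \<forall>f \<in> Hom C c (omap p_up d).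
            has_cartesian_lifting D C p_up d f \<longleftrightarrow>
            (\<exists>d' r q. is_pullback D (\<eta> d) (amap p_low f) d' r q \<and>
                      is_iso C (adj_transpose C p_up \<epsilon> c q)))
       \<and> (fibration D C p_up \<longleftrightarrow>
          (\<forall>d \<in> Obj D. \<forall>c. \<forall>f \<in> Hom C c (omap p_up d).
            \<exists>d' r q. is_pullback D (\<eta> d) (amap p_low f) d' r q \<and>
                     is_iso C (adj_transpose C p_up \<epsilon> c q)))"
proof -
  interpret adjunction D C p_up p_low \<eta> \<epsilon> by (rule assms)
  show ?thesis
    unfolding fibration_def
    using has_cartesian_lifting_iff_pullback L.is_ftor_axioms by simp
qed

end
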